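(* Let $(\mathcal{S},\mathcal{A},P)$ be the state space, action space and transition probabilities of an MDP, and let $s_t,a_t\to s_{t+1}$ be an observed transition, so $P(s_{t+1}\mid s_t,a_t)>0$. Let $\tilde P_t^{LB}(\tilde s'\mid \tilde s,\tilde a)$ and $\tilde P_t^{UB}(\tilde s'\mid \tilde s,\tilde a)$ be the minimum and maximum of $\tilde P_t^{\theta}(\tilde s'\mid \tilde s,\tilde a)$ over all feasible $\theta$ (feasibility, including counterfactual stability and monotonicity, as defined in the context). Then for every state-action pair $(\tilde s,\tilde a)\ne(s_t,a_t)$ whose support is disjoint from the support of $(s_t,a_t)$, and every $\tilde s'\in\mathcal{S}$: $$\tilde P_t^{UB}(\tilde s'\mid\tilde s,\tilde a)=\begin{cases}\dfrac{P(\tilde s'\mid\tilde s,\tilde a)}{P(s_{t+1}\mid s_t,a_t)} & \text{if } P(\tilde s'\mid\tilde s,\tilde a)<P(s_{t+1}\mid s_t,a_t),\\[2mm] 1&\text{otherwise,}\end{cases}$$ $$\tilde P_t^{LB}(\tilde s'\mid\tilde s,\tilde a)=\begin{cases}\dfrac{P(\tilde s'\mid\tilde s,\tilde a)-\bigl(1-P(s_{t+1}\mid s_t,a_t)\bigr)}{P(s_{t+1}\mid s_t,a_t)} & \text{if } P(\tilde s'\mid\tilde s,\tilde a)>1-P(s_{t+1}\mid s_t,a_t),\\[2mm] 0&\text{otherwise.}\end{cases}$$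
   Context: $\mathcal{S}$ (states) and $\mathcal{A}$ (actions) are finite nonempty sets and $P(\cdot\mid s,a)$ is a probability distribution on $\mathcal{S}$ for every $(s,a)\in\mathcal{S}\times\mathcal{A}$. The support of $(s,a)$ is $\{s'\in\mathcal{S}: P(s'\mid s,a)>0\}$. Canonical SCM: let $U_t$ be the finite set indexing all functions $\mathcal{S}\times\mathcal{A}\to\mathcal{S}$, so $|U_t|=|\mathcal{S}|^{|\mathcal{S}||\mathcal{A}|}$; write $f(s,a,u)\in\mathcal{S}$ for the value at $(s,a)$ of the function indexed by $u\in U_t$, and $\mu_{s,a,u,s'}=1$ if $f(s,a,u)=s'$ and $0$ otherwise. A vector $\theta\in\mathbb{R}^{U_t}$ represents a distribution on $U_t$. Given the observed transition $s_t,a_t\to s_{t+1}$ with $P(s_{t+1}\mid s_t,a_t)>0$, the counterfactual probability induced by $\theta$ is $$\tilde P_t^{\theta}(\tilde s'\mid\tilde s,\tilde a)=\frac{\sum_{u\in U_t}\mu_{\tilde s,\tilde a,u,\tilde s'}\,\mu_{s_t,a_t,u,s_{t+1}}\,\theta_u}{P(s_{t+1}\mid s_t,a_t)}.$$ $\theta$ is feasible if all of the following hold: (Prob) $0\le\theta_u\le1$ for all $u$ and $\sum_u\theta_u=1$; (Int) $\sum_u\mu_{s,a,u,s'}\theta_u=P(s'\mid s,a)$ for all $s,a,s'$; (CS, counterfactual stability) for all $(\tilde s,\tilde a)\ne(s_t,a_t)$ and all $\tilde s'\ne s_{t+1}$ with $P(\tilde s'\mid s_t,a_t)>0$ and $\frac{P(s_{t+1}\mid\tilde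 s,\tilde a)}{P(s_{t+1}\mid s_t,a_t)}\ge\frac{P(\tilde s'\mid\tilde s,\tilde a)}{P(\tilde s'\mid s_t,a_t)}$, one has $\tilde P^\theta_t(\tilde s'\mid\tilde s,\tilde a)=0$; (Mon1) for all $\tilde s,\tilde a$ with $P(s_{t+1}\mid\tilde s,\tilde a)>0$: $\tilde P^\theta_t(s_{t+1}\mid\tilde s,\tilde a)\ge P(s_{t+1}\mid\tilde s,\tilde a)$; (Mon2) for all $\tilde s,\tilde a$ and all $\tilde s'\ne s_{t+1}$ with $P(\tilde s'\mid s_t,a_t)>0$: $\tilde P^\theta_t(\tilde s'\mid\tilde s,\tilde a)\le P(\tilde s'\mid\tilde s,\tilde a)$. The assertion that the minimum/maximum equals a value includes that it is attained (in particular that a feasible $\theta$ exists). *)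

theory Defs
  imports "HOL-Probability.Probability"
begin

text \<open>States and actions are finite types, and \<open>P s a\<close> is the next-state distribution.
  The exogenous index set is the type of all functions from state-action pairs to states, each
  function being its own index; an index \<open>u\<close> therefore has \<open>f(s,a,u) = u (s, a)\<close>. Vectors over
  that index set are real-valued functions on it.\<close>

type_synonym ('s, 'a) mech = "'s \<times> 'a \<Rightarrow> 's"

definition mech_val :: "'s \<Rightarrow> 'a \<Rightarrow> ('s, 'a) mech \<Rightarrow> 's" where
  "mech_val s a u = u (s, a)"

definition mu :: "'s \<Rightarrow> 'a \<Rightarrow> ('s, 'a) mech \<Rightarrow> 's \<Rightarrow> real" where
  "mu s a u s' = (if mech_val s a u = s' then 1 else 0)"

text \<open>In all definitions below, \<open>s0, a0\<close> and \<open>s1\<close> are the observed state, action and next state.\<close>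

definition cf_prob ::
  "('s::finite \<Rightarrow> 'a::finite \<Rightarrow> 's pmf) \<Rightarrow> 's \<Rightarrow> 'a \<Rightarrow> 's \<Rightarrow> (('s, 'a) mech \<Rightarrow> real)
    \<Rightarrow> 's \<Rightarrow> 'a \<Rightarrow> 's \<Rightarrow> real" where
  "cf_prob P s0 a0 s1 \<theta> s a s' =
     (\<Sum>u\<in>UNIV. mu s a u s' * mu s0 a0 u s1 * \<theta> u) / pmf (P s0 a0) s1"

definition prob_vector :: "(('s::finite, 'a::finite) mech \<Rightarrow> real) \<Rightarrow> bool" where
  "prob_vector \<theta> \<longleftrightarrow> (\<forall>u. 0 \<le> \<theta> u \<and> \<theta> u \<le> 1) \<and> (\<Sum>u\<in>UNIV. \<theta> u) = 1"

definition matches_interventional ::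
  "('s::finite \<Rightarrow> 'a::finite \<Rightarrow> 's pmf) \<Rightarrow> (('s, 'a) mech \<Rightarrow> real) \<Rightarrow> bool" where
  "matches_interventional P \<theta> \<longleftrightarrow>
     (\<forall>s a s'. (\<Sum>u\<in>UNIV. mu s a u s' * \<theta> u) = pmf (P s a) s')"

definition counterfactually_stable ::
  "('s::finite \<Rightarrow> 'a::finite \<Rightarrow> 's pmf) \<Rightarrow> 's \<Rightarrow> 'a \<Rightarrow> 's \<Rightarrow> (('s, 'a) mech \<Rightarrow> real) \<Rightarrow> bool" where
  "counterfactually_stable P s0 a0 s1 \<theta> \<longleftrightarrow>
     (\<forall>s a s'. (s, a) \<noteq> (s0, a0) \<longrightarrow> s' \<noteq> s1 \<longrightarrow> pmf (P s0 a0) s' > 0 \<longrightarrow>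
        pmf (P s a) s1 / pmf (P s0 a0) s1 \<ge> pmf (P s a) s' / pmf (P s0 a0) s' \<longrightarrow>
        cf_prob P s0 a0 s1 \<theta> s a s' = 0)"

definition monotone_observed ::
  "('s::finite \<Rightarrow> 'a::finite \<Rightarrow> 's pmf) \<Rightarrow> 's \<Rightarrow> 'a \<Rightarrow> 's \<Rightarrow> (('s, 'a) mech \<Rightarrow> real) \<Rightarrow> bool" where
  "monotone_observed P s0 a0 s1 \<theta> \<longleftrightarrow>
     (\<forall>s a. pmf (P s a) s1 > 0 \<longrightarrow> cf_prob P s0 a0 s1 \<theta> s a s1 \<ge> pmf (P s a) s1)"

definition monotone_unobserved ::
  "('s::finite \<Rightarrow> 'a::finite \<Rightarrow> 's pmf) \<Rightarrow> 's \<Rightarrow> 'a \<Rightarrow> 's \<Rightarrow> (('s, 'a) mech \<Rightarrow> real) \<Rightarrow> bool" where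
  "monotone_unobserved P s0 a0 s1 \<theta> \<longleftrightarrow>
     (\<forall>s a s'. s' \<noteq> s1 \<longrightarrow> pmf (P s0 a0) s' > 0 \<longrightarrow>
        cf_prob P s0 a0 s1 \<theta> s a s' \<le> pmf (P s a) s')"

definition feasible ::
  "('s::finite \<Rightarrow> 'a::finite \<Rightarrow> 's pmf) \<Rightarrow> 's \<Rightarrow> 'a \<Rightarrow> 's \<Rightarrow> (('s, 'a) mech \<Rightarrow> real) \<Rightarrow> bool" where
  "feasible P s0 a0 s1 \<theta> \<longleftrightarrow>
     prob_vector \<theta> \<and> matches_interventional P \<theta> \<and> counterfactually_stable P s0 a0 s1 \<theta> \<and>
     monotone_observed P s0 a0 s1 \<theta> \<and> monotone_unobserved P s0 a0 s1 \<theta>"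

text \<open>The bounds are stated as predicates rather than as \<open>Inf\<close> and \<open>Sup\<close>, so that attainment,
  and hence existence of a feasible vector, is part of the claim.\<close>

definition is_cf_maximum ::
  "('s::finite \<Rightarrow> 'a::finite \<Rightarrow> 's pmf) \<Rightarrow> 's \<Rightarrow> 'a \<Rightarrow> 's \<Rightarrow> 's \<Rightarrow> 'a \<Rightarrow> 's \<Rightarrow> real \<Rightarrow> bool" where
  "is_cf_maximum P s0 a0 s1 s a s' v \<longleftrightarrow>
     (\<exists>\<theta>. feasible P s0 a0 s1 \<theta> \<and> cf_prob P s0 a0 s1 \<theta> s a s' = v) \<and>
     (\<forall>\<theta>. feasible P s0 a0 s1 \<theta> \<longrightarrow> cf_prob P s0 a0 s1 \<theta> s a s' \<le> v)"

definition is_cf_minimum ::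
  "('s::finite \<Rightarrow> 'a::finite \<Rightarrow> 's pmf) \<Rightarrow> 's \<Rightarrow> 'a \<Rightarrow> 's \<Rightarrow> 's \<Rightarrow> 'a \<Rightarrow> 's \<Rightarrow> real \<Rightarrow> bool" where
  "is_cf_minimum P s0 a0 s1 s a s' v \<longleftrightarrow>
     (\<exists>\<theta>. feasible P s0 a0 s1 \<theta> \<and> cf_prob P s0 a0 s1 \<theta> s a s' = v) \<and>
     (\<forall>\<theta>. feasible P s0 a0 s1 \<theta> \<longrightarrow> v \<le> cf_prob P s0 a0 s1 \<theta> s a s')"

end

theory Submission
  imports Defs
begin

text \<open>For a feasible \<open>\<theta>\<close> the numerator of the counterfactual probability is the mass of an
  intersection of two events with prescribed probabilities, so the Frechet bounds apply. They are
  attained because the constraints decouple over state-action pairs. Write \<open>p\<close> for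
  \<open>P(s1 | s0, a0)\<close> and choose for each pair \<open>z\<close> a counterfactual row \<open>q z\<close> with
  \<open>p * q z \<le> P z\<close>, where the row of \<open>(s0, a0)\<close> is the point mass at \<open>s1\<close>. The mixture, with weights
  \<open>p\<close> and \<open>1 - p\<close>, of the product of the \<open>q z\<close> and the product of the \<open>(P z - p * q z) / (1 - p)\<close>
  has the marginals \<open>P z\<close>, and its counterfactual probabilities are the \<open>q z\<close>. It remains to find
  rows obeying stability and monotonicity one pair at a time. For a pair whose support is disjoint
  from that of \<open>(s0, a0)\<close> these conditions follow from \<open>p * q z \<le> P z\<close>.\<close>

section \<open>Interpolation and product weights\<close>

text \<open>Along the segment from \<open>l\<close> to \<open>u\<close> the sum is affine in the
  parameter, so it passes through \<open>c\<close>.\<close>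

lemma exists_between_with_sum:
  fixes l u :: "'b \<Rightarrow> real"
  assumes le: "\<And>x. x \<in> A \<Longrightarrow> l x \<le> u x" and lo: "sum l A \<le> c" and hi: "c \<le> sum u A"
  obtains q where "\<And>x. x \<in> A \<Longrightarrow> l x \<le> q x" "\<And>x. x \<in> A \<Longrightarrow> q x \<le> u x" "sum q A = c"
proof -
  define t where "t = (if sum u A = sum l A then 0 else (c - sum l A) / (sum u A - sum l A))"
  have t: "0 \<le> t" "t \<le> 1" "t * (sum u A - sum l A) = c - sum l A"
    using lo hi by (cases "sum u A = sum l A"; simp add: t_def divide_le_eq)+
  define q where "q x = l x + t * (u x - l x)" for x
  have "sum q A = c"
    using t(3) by (simp add: q_def sum.distrib sum_subtractf flip: sum_distrib_left)
  moreover have "l x \<le> q x" "q x \<le> u x" if "x \<in> A" for x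
    using le[OF that] t mult_left_le_one_le[of "u x - l x" t] by (auto simp: q_def)
  ultimately show ?thesis by (intro that[of q])
qed

lemma sum_product_weight_marginal:
  fixes f :: "'i::finite \<Rightarrow> 'b::finite \<Rightarrow> real"
  assumes "\<And>i. (\<Sum>x\<in>UNIV. f i x) = 1"
  shows "(\<Sum>g\<in>UNIV. h (g i) * (\<Prod>j\<in>UNIV. f j (g j))) = (\<Sum>x\<in>UNIV. h x * f i x)"
proof -
  \<comment> \<open>Absorbing \<open>h\<close> into the factor at \<open>i\<close> leaves a pure
    product, whose sum over all functions factorizes.\<close>
  define f' where "f' = (\<lambda>j x. (if j = i then h x else 1) * f j x)"
  have "(\<Sum>g\<in>UNIV. h (g i) * (\<Prod>j\<in>UNIV. f j (g j))) = (\<Sum>g\<in>UNIV. \<Prod>j\<in>UNIV. f' j (g j))"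
    by (simp add: f'_def prod.distrib)
  also have "\<dots> = (\<Prod>j\<in>UNIV. \<Sum>x\<in>UNIV. f' j x)"
    using prod_sum_PiE[of UNIV "\<lambda>_. UNIV" f'] by simp
  also have "\<dots> = (\<Prod>j\<in>UNIV. if j = i then \<Sum>x\<in>UNIV. h x * f i x else 1)"
    by (intro prod.cong) (auto simp: f'_def assms)
  finally show ?thesis by simp
qed

lemma sum_pmf_UNIV [simp]: "(\<Sum>x\<in>UNIV. pmf (p :: 'b::finite pmf) x) = 1"
  by (rule sum_pmf_eq_1) auto

section \<open>Mechanism distributions with prescribed counterfactual rows\<close>

text \<open>Since the row at \<open>(s0, a0)\<close> is a point mass, the first mixture component
  lives on the event \<open>u (s0, a0) = s1\<close> and the second off it. Restricting to the
  observation therefore keeps exactly the first.\<close>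

lemma exists_mech_distribution:
  fixes P :: "'s::finite \<Rightarrow> 'a::finite \<Rightarrow> 's pmf" and q :: "'s \<times> 'a \<Rightarrow> 's \<Rightarrow> real"
  assumes observed: "pmf (P s0 a0) s1 > 0"
    and nonneg: "\<And>z x. 0 \<le> q z x"
    and sum1: "\<And>z. (\<Sum>x\<in>UNIV. q z x) = 1"
    and le: "\<And>s a x. pmf (P s0 a0) s1 * q (s, a) x \<le> pmf (P s a) x"
    and point: "\<And>x. q (s0, a0) x = of_bool (x = s1)"
  obtains \<theta> where "prob_vector \<theta>" "matches_interventional P \<theta>"
    "\<And>s a x. cf_prob P s0 a0 s1 \<theta> s a x = q (s, a) x"
proof -
  define p where "p = pmf (P s0 a0) s1"
  have p: "0 < p" "p \<le> 1" using observed by (auto simp: p_def pmf_le_1)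
  \<comment> \<open>For \<open>p = 1\<close> division by zero makes \<open>r\<close> zero, and its
    weight \<open>1 - p\<close> is zero too.\<close>
  define r where "r z x = (pmf (P (fst z) (snd z)) x - p * q z x) / (1 - p)" for z x
  define \<theta> where "\<theta> u = p * (\<Prod>z\<in>UNIV. q z (u z)) + (1 - p) * (\<Prod>z\<in>UNIV. r z (u z))"
    for u :: "('s, 'a) mech"
  have r_nonneg: "0 \<le> r z x" for z x
    using le[of "fst z" "snd z" x] p by (simp add: r_def p_def[symmetric])
  have r_sum: "(\<Sum>x\<in>UNIV. r z x) = 1" if "p < 1" for z
    using that by (simp add: r_def sum1 sum_subtractf flip: sum_divide_distrib sum_distrib_left)
  have pr: "(1 - p) * r (s, a) x = pmf (P s a) x - p * q (s, a) x" for s a x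
  proof (cases "p = 1")
    case True
    have "(\<Sum>x\<in>UNIV. pmf (P s a) x - q (s, a) x) = 0"
      by (simp add: sum_subtractf sum1)
    then have "pmf (P s a) x - q (s, a) x = 0"
      using le[of s a] True by (subst (asm) sum_nonneg_eq_0_iff) (auto simp: p_def[symmetric])
    with True show ?thesis by simp
  qed (simp add: r_def)
  have marginal: "(\<Sum>u\<in>UNIV. h (u (s, a)) * \<theta> u) = (\<Sum>x\<in>UNIV. h x * pmf (P s a) x)"
    for h s a
  proof -
    have *: "(1 - p) * (\<Sum>u\<in>UNIV. h (u (s, a)) * (\<Prod>z\<in>UNIV. r z (u z)))
        = (1 - p) * (\<Sum>x\<in>UNIV. h x * r (s, a) x)"
      using sum_product_weight_marginal[of r h "(s, a)"] r_sum p by (cases "p = 1") auto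
    have "(\<Sum>u\<in>UNIV. h (u (s, a)) * \<theta> u)
        = p * (\<Sum>u\<in>UNIV. h (u (s, a)) * (\<Prod>z\<in>UNIV. q z (u z)))
          + (1 - p) * (\<Sum>u\<in>UNIV. h (u (s, a)) * (\<Prod>z\<in>UNIV. r z (u z)))"
      by (simp add: \<theta>_def sum_distrib_left sum.distrib distrib_left mult.left_commute)
    also have "\<dots> = (\<Sum>x\<in>UNIV. h x * (p * q (s, a) x + (1 - p) * r (s, a) x))"
      unfolding * sum_product_weight_marginal[where f = q, OF sum1]
      by (simp add: sum_distrib_left sum.distrib distrib_left mult.left_commute)
    also have "\<dots> = (\<Sum>x\<in>UNIV. h x * pmf (P s a) x)" by (simp add: pr)
    finally show ?thesis .
  qed
  have \<theta>_nonneg: "0 \<le> \<theta> u" for u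
    using p nonneg r_nonneg by (auto simp: \<theta>_def intro!: add_nonneg_nonneg mult_nonneg_nonneg prod_nonneg)
  have \<theta>_sum: "(\<Sum>u\<in>UNIV. \<theta> u) = 1" using marginal[of "\<lambda>_. 1"] by simp
  have "\<theta> u \<le> 1" for u
    using member_le_sum[of u UNIV \<theta>] \<theta>_nonneg \<theta>_sum by auto
  then have "prob_vector \<theta>" using \<theta>_nonneg \<theta>_sum by (simp add: prob_vector_def)
  moreover have "matches_interventional P \<theta>"
    unfolding matches_interventional_def
  proof (intro allI)
    fix s a s'
    show "(\<Sum>u\<in>UNIV. mu s a u s' * \<theta> u) = pmf (P s a) s'"
      using marginal[of "\<lambda>x. of_bool (x = s')" s a]
      by (simp add: mu_def mech_val_def of_bool_def if_distrib[of "\<lambda>t. t * _"] cong: if_cong)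
  qed
  moreover have "cf_prob P s0 a0 s1 \<theta> s a x = q (s, a) x" for s a x
  proof -
    have q_part: "mu s0 a0 u s1 * (\<Prod>z\<in>UNIV. q z (u z)) = (\<Prod>z\<in>UNIV. q z (u z))" for u
      using point by (auto simp: mu_def mech_val_def intro!: exI[of _ s0] exI[of _ a0])
    \<comment> \<open>If \<open>u (s0, a0) = s1\<close>, the factor at \<open>(s0, a0)\<close> is
      \<open>(p - p * 1) / (1 - p) = 0\<close>.\<close>
    have r_part: "mu s0 a0 u s1 * (\<Prod>z\<in>UNIV. r z (u z)) = 0" for u
      using point by (auto simp: mu_def mech_val_def r_def p_def intro!: exI[of _ s0] exI[of _ a0])
    have "mu s0 a0 u s1 * \<theta> u = p * (\<Prod>z\<in>UNIV. q z (u z))" for u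
      unfolding \<theta>_def distrib_left mult.left_commute[of "mu s0 a0 u s1"] q_part r_part by simp
    then have "(\<Sum>u\<in>UNIV. mu s a u x * mu s0 a0 u s1 * \<theta> u)
        = p * (\<Sum>u\<in>UNIV. of_bool (u (s, a) = x) * (\<Prod>z\<in>UNIV. q z (u z)))"
      by (simp add: mult.assoc sum_distrib_left mult.left_commute mu_def mech_val_def of_bool_def)
    also have "\<dots> = p * q (s, a) x"
      using sum_product_weight_marginal[where f = q, OF sum1, of "\<lambda>y. of_bool (y = x)"]
      by (simp add: of_bool_def if_distrib[of "\<lambda>t. t * _"] cong: if_cong)
    finally show ?thesis using p by (simp add: cf_prob_def p_def[symmetric])
  qed
  ultimately show ?thesis by (rule that)
qed

section \<open>Rows obeying stability and monotonicity\<close>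

text \<open>What feasibility asks of a single pair, with the counterfactual row \<open>q\<close> as
  the only unknown. The bound on \<open>pmf P0 s1 * q x\<close> keeps the second mixture component
  nonnegative.\<close>

definition admissible_row :: "'s::finite pmf \<Rightarrow> 's \<Rightarrow> 's pmf \<Rightarrow> ('s \<Rightarrow> real) \<Rightarrow> bool" where
  "admissible_row P0 s1 R q \<longleftrightarrow>
     (\<forall>x. 0 \<le> q x) \<and> (\<Sum>x\<in>UNIV. q x) = 1 \<and> (\<forall>x. pmf P0 s1 * q x \<le> pmf R x) \<and>
     (\<forall>x. x \<noteq> s1 \<longrightarrow> pmf P0 x > 0 \<longrightarrow> pmf R s1 / pmf P0 s1 \<ge> pmf R x / pmf P0 x \<longrightarrow> q x = 0) \<and>
     pmf R s1 \<le> q s1 \<and> (\<forall>x. x \<noteq> s1 \<longrightarrow> pmf P0 x > 0 \<longrightarrow> q x \<le> pmf R x)"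

text \<open>Stability and monotonicity concern one pair at a time, so rows can be chosen
  independently. At \<open>(s0, a0)\<close> stability asks nothing and the point mass is
  monotone.\<close>

lemma exists_feasible_with_rows:
  fixes P :: "'s::finite \<Rightarrow> 'a::finite \<Rightarrow> 's pmf"
  assumes observed: "pmf (P s0 a0) s1 > 0"
    and rows: "\<And>s a. (s, a) \<noteq> (s0, a0) \<Longrightarrow> admissible_row (P s0 a0) s1 (P s a) (q (s, a))"
  obtains \<theta> where "feasible P s0 a0 s1 \<theta>"
    "\<And>s a x. (s, a) \<noteq> (s0, a0) \<Longrightarrow> cf_prob P s0 a0 s1 \<theta> s a x = q (s, a) x"
proof -
  define q' where "q' = q((s0, a0) := \<lambda>x. of_bool (x = s1))"
  have q': "q' (s, a) = q (s, a)" if "(s, a) \<noteq> (s0, a0)" for s a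
    using that by (auto simp: q'_def)
  have q'0: "q' (s0, a0) x = of_bool (x = s1)" for x by (simp add: q'_def)
  have "0 \<le> q' z x" for z x
    using rows[of "fst z" "snd z"] by (cases "z = (s0, a0)") (auto simp: q'_def admissible_row_def)
  moreover have "(\<Sum>x\<in>UNIV. q' z x) = 1" for z
    using rows[of "fst z" "snd z"]
    by (cases "z = (s0, a0)") (auto simp: q'_def admissible_row_def of_bool_def)
  moreover have "pmf (P s0 a0) s1 * q' (s, a) x \<le> pmf (P s a) x" for s a x
    using rows[of s a] by (cases "(s, a) = (s0, a0)") (auto simp: q'_def admissible_row_def)
  ultimately obtain \<theta> where \<theta>: "prob_vector \<theta>" "matches_interventional P \<theta>"
    "\<And>s a x. cf_prob P s0 a0 s1 \<theta> s a x = q' (s, a) x"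
    using exists_mech_distribution[of P s0 a0 s1 q'] observed q'0 by metis
  have "counterfactually_stable P s0 a0 s1 \<theta>"
    using rows by (simp add: counterfactually_stable_def \<theta> q' admissible_row_def)
  moreover have "pmf (P s a) s1 \<le> q' (s, a) s1" for s a
    using rows[of s a] by (cases "(s, a) = (s0, a0)") (auto simp: q'_def admissible_row_def pmf_le_1)
  then have "monotone_observed P s0 a0 s1 \<theta>" by (simp add: monotone_observed_def \<theta>)
  moreover have "q' (s, a) x \<le> pmf (P s a) x" if "x \<noteq> s1" "pmf (P s0 a0) x > 0" for s a x
    using rows[of s a] that by (cases "(s, a) = (s0, a0)") (auto simp: q'_def admissible_row_def)
  then have "monotone_unobserved P s0 a0 s1 \<theta>" by (simp add: monotone_unobserved_def \<theta>)
  ultimately show ?thesis using \<theta> q' by (intro that[of \<theta>]) (simp_all add: feasible_def)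
qed

text \<open>Apart from the total mass, the conditions bound single entries, below by
  \<open>l\<close> and above by \<open>u\<close>. It remains to see that 1 lies between the sums of
  these bounds.\<close>

lemma exists_admissible_row:
  fixes P0 R :: "'s::finite pmf"
  assumes p: "pmf P0 s1 > 0"
  shows "\<exists>q. admissible_row P0 s1 R q"
proof -
  define p r where "p = pmf P0 s1" and "r = pmf R s1"
  have p: "0 < p" "p \<le> 1" using p by (auto simp: p_def pmf_le_1)
  have r: "0 \<le> r" "r \<le> 1" by (auto simp: r_def pmf_le_1)
  have r_le: "r \<le> r / p" using p r by (simp add: le_divide_eq mult_left_le)
  define l where "l x = (if x = s1 then r else 0)" for x
  \<comment> \<open>The cases come, in order, from \<open>p * q x \<le> pmf R x\<close> at
    \<open>s1\<close>, the same bound off the support of \<open>P0\<close>, stability, and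
    monotonicity.\<close>
  define u where "u x = (if x = s1 then r / p else if pmf P0 x = 0 then pmf R x / p
      else if pmf R x / pmf P0 x \<le> r / p then 0 else pmf R x)" for x
  have R_le: "pmf R x \<le> pmf R x / p" for x
    using p by (simp add: le_divide_eq mult_left_le)
  have "l x \<le> u x" for x using r_le p by (auto simp: l_def u_def)
  moreover have "sum l UNIV \<le> 1" using r by (simp add: l_def)
  moreover have "1 \<le> sum u UNIV"
  proof -
    text \<open>The states at which stability forces 0 lose at most the mass \<open>(1 - p) * r / p\<close>, which
      is what \<open>u s1\<close> gains over \<open>r\<close>.\<close>
    have "pmf R x - (r / p) * pmf P0 x \<le> u x" if "x \<noteq> s1" for x
    proof (cases "pmf P0 x = 0")
      case True
      then show ?thesis using that R_le by (simp add: u_def)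
    next
      case False
      then have "0 < pmf P0 x" by (simp add: pmf_pos)
      moreover have "0 \<le> (r / p) * pmf P0 x" using p r by simp
      ultimately show ?thesis using that by (auto simp: u_def divide_le_eq)
    qed
    then have "(\<Sum>x\<in>UNIV - {s1}. pmf R x - (r / p) * pmf P0 x) \<le> sum u (UNIV - {s1})"
      by (intro sum_mono) auto
    \<comment> \<open>The sum is \<open>(1 - r) - (r / p) * (1 - p)\<close>.\<close>
    moreover have "(\<Sum>x\<in>UNIV - {s1}. pmf R x - (r / p) * pmf P0 x) = 1 - r / p"
      using p by (simp add: sum_diff1 sum_subtractf p_def[symmetric] r_def[symmetric]
          right_diff_distrib
          del: times_divide_eq_left flip: sum_distrib_left) simp
    moreover have "sum u UNIV = r / p + sum u (UNIV - {s1})"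
      by (subst sum.remove[of _ s1]) (auto simp: u_def)
    ultimately show ?thesis by simp
  qed
  ultimately obtain q where q: "\<And>x. l x \<le> q x" "\<And>x. q x \<le> u x" "sum q UNIV = 1"
    using exists_between_with_sum[of UNIV l u 1] by auto
  have nonneg: "0 \<le> q x" for x using q(1)[of x] r by (auto simp: l_def split: if_splits)
  have "u x \<le> pmf R x / p" for x using p R_le by (auto simp: u_def r_def)
  then have "p * q x \<le> pmf R x" for x
    using q(2)[of x] p by (metis le_divide_eq mult.commute order_trans)
  moreover have "q x = 0" if "x \<noteq> s1" "pmf P0 x > 0" "pmf R x / pmf P0 x \<le> r / p" for x
    using q(2)[of x] nonneg[of x] that by (simp add: u_def)
  moreover have "r \<le> q s1" using q(1)[of s1] by (simp add: l_def)
  moreover have "q x \<le> pmf R x" if "x \<noteq> s1" "pmf P0 x > 0" for x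
    using q(2)[of x] that by (auto simp: u_def split: if_splits intro: order_trans)
  ultimately have "admissible_row P0 s1 R q"
    using nonneg q(3) by (simp add: admissible_row_def p_def r_def)
  then show ?thesis by blast
qed

text \<open>With the entry at \<open>s'\<close> fixed to \<open>v\<close>, the other entries are
  capped by \<open>pmf R x / pmf P0 s1\<close>. The last hypothesis on \<open>v\<close> says that
  these caps leave room for the remaining mass \<open>1 - v\<close>.\<close>

lemma exists_admissible_row_disjoint:
  fixes P0 R :: "'s::finite pmf"
  assumes p: "pmf P0 s1 > 0" and disj: "set_pmf R \<inter> set_pmf P0 = {}"
    and v: "0 \<le> v" "v \<le> 1" "pmf P0 s1 * v \<le> pmf R s'"
      "pmf P0 s1 * (1 - v) \<le> 1 - pmf R s'"
  shows "\<exists>q. admissible_row P0 s1 R q \<and> q s' = v"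
proof -
  define p where "p = pmf P0 s1"
  have p: "0 < p" using p by (simp add: p_def)
  define l where "l x = (if x = s' then v else 0)" for x
  define u where "u x = (if x = s' then v else pmf R x / p)" for x
  have l_le: "l x \<le> u x" for x using p by (auto simp: l_def u_def)
  have l_sum: "sum l UNIV \<le> 1" using v by (simp add: l_def)
  have "sum u UNIV = v + (1 - pmf R s') / p"
    by (subst sum.remove[of _ s'])
      (auto simp: u_def sum_diff1 simp flip: sum_divide_distrib)
  moreover have "1 - v \<le> (1 - pmf R s') / p"
    using v(4) p by (simp add: p_def[symmetric] le_divide_eq mult.commute)
  ultimately have "1 \<le> sum u UNIV" by simp
  with l_le l_sum obtain q where q: "\<And>x. l x \<le> q x" "\<And>x. q x \<le> u x" "sum q UNIV = 1"
    using exists_between_with_sum[of UNIV l u 1] by auto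
  have nonneg: "0 \<le> q x" for x using q(1)[of x] v by (auto simp: l_def split: if_splits)
  have le: "p * q x \<le> pmf R x" for x
  proof -
    have "p * q x \<le> p * u x" using q(2)[of x] p by simp
    also have "\<dots> \<le> pmf R x" using v(3) p by (simp add: u_def p_def[symmetric])
    finally show ?thesis .
  qed
  have R0: "pmf R x = 0" if "pmf P0 x > 0" for x
    using disj that by (auto simp: set_pmf_eq)
  \<comment> \<open>This includes \<open>x = s1\<close>, where monotonicity becomes
    \<open>0 \<le> 0\<close>.\<close>
  have q0: "q x = 0" if "pmf P0 x > 0" for x
    using le[of x] R0[OF that] nonneg[of x] p by (simp add: mult_le_0_iff)
  have "admissible_row P0 s1 R q"
    unfolding admissible_row_def
    using nonneg q(3) le q0 R0 p by (auto simp: p_def)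
  moreover have "q s' = v" using q(1,2)[of s'] by (simp add: l_def u_def)
  ultimately show ?thesis by blast
qed

lemma exists_feasible_disjoint:
  fixes P :: "'s::finite \<Rightarrow> 'a::finite \<Rightarrow> 's pmf"
  assumes observed: "pmf (P s0 a0) s1 > 0"
    and other: "(s, a) \<noteq> (s0, a0)"
    and disjoint: "set_pmf (P s a) \<inter> set_pmf (P s0 a0) = {}"
    and v: "0 \<le> v" "v \<le> 1" "pmf (P s0 a0) s1 * v \<le> pmf (P s a) s'"
      "pmf (P s0 a0) s1 * (1 - v) \<le> 1 - pmf (P s a) s'"
  shows "\<exists>\<theta>. feasible P s0 a0 s1 \<theta> \<and> cf_prob P s0 a0 s1 \<theta> s a s' = v"
proof -
  obtain q1 where q1: "admissible_row (P s0 a0) s1 (P s a) q1" "q1 s' = v"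
    using exists_admissible_row_disjoint[OF observed disjoint v] by blast
  have "\<exists>q. \<forall>z. admissible_row (P s0 a0) s1 (P (fst z) (snd z)) (q z)"
    by (intro choice allI exists_admissible_row observed)
  then obtain q where q: "admissible_row (P s0 a0) s1 (P (fst z) (snd z)) (q z)" for z
    by blast
  define q' where "q' = q((s, a) := q1)"
  have "admissible_row (P s0 a0) s1 (P t b) (q' (t, b))" for t b
    using q[of "(t, b)"] q1 by (auto simp: q'_def)
  then obtain \<theta> where "feasible P s0 a0 s1 \<theta>"
    "\<And>t b x. (t, b) \<noteq> (s0, a0) \<Longrightarrow> cf_prob P s0 a0 s1 \<theta> t b x = q' (t, b) x"
    using exists_feasible_with_rows[of P s0 a0 s1 q'] observed by metis
  with other q1 show ?thesis by (intro exI[of _ \<theta>]) (simp add: q'_def)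
qed

section \<open>Frechet bounds and extreme values\<close>

text \<open>Two events of mass \<open>r\<close> and \<open>p\<close> meet in mass at least
  \<open>max 0 (r + p - 1)\<close> and at most \<open>min r p\<close>; dividing by \<open>p\<close>
  gives the four bounds.\<close>

lemma cf_prob_frechet_bounds:
  fixes P :: "'s::finite \<Rightarrow> 'a::finite \<Rightarrow> 's pmf" and s s' :: 's and a :: 'a
  assumes observed: "pmf (P s0 a0) s1 > 0"
    and prob: "prob_vector \<theta>" and int: "matches_interventional P \<theta>"
  defines "p \<equiv> pmf (P s0 a0) s1" and "r \<equiv> pmf (P s a) s'"
  shows "cf_prob P s0 a0 s1 \<theta> s a s' \<le> 1" "cf_prob P s0 a0 s1 \<theta> s a s' \<le> r / p"
    "0 \<le> cf_prob P s0 a0 s1 \<theta> s a s'" "(r - (1 - p)) / p \<le> cf_prob P s0 a0 s1 \<theta> s a s'"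
proof -
  define N where "N = (\<Sum>u\<in>UNIV. mu s a u s' * mu s0 a0 u s1 * \<theta> u)"
  have p: "0 < p" using observed by (simp add: p_def)
  have nonneg: "0 \<le> \<theta> u" for u using prob by (simp add: prob_vector_def)
  have total: "(\<Sum>u\<in>UNIV. \<theta> u) = 1" using prob by (simp add: prob_vector_def)
  have m: "(\<Sum>u\<in>UNIV. mu s a u s' * \<theta> u) = r" "(\<Sum>u\<in>UNIV. mu s0 a0 u s1 * \<theta> u) = p"
    using int by (simp_all add: matches_interventional_def p_def r_def)
  have "N \<le> r" "N \<le> p"
    unfolding m[symmetric] N_def by (auto intro!: sum_mono simp: mu_def nonneg)
  moreover have "0 \<le> N" unfolding N_def by (auto intro!: sum_nonneg simp: mu_def nonneg)
  \<comment> \<open>Pointwise, two indicators satisfy \<open>x + y - 1 \<le> x * y\<close>.\<close>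
  moreover have "r + p - 1 \<le> N"
    unfolding m[symmetric] total[symmetric] N_def sum.distrib[symmetric] sum_subtractf[symmetric]
    by (auto intro!: sum_mono simp: mu_def nonneg)
  moreover have "cf_prob P s0 a0 s1 \<theta> s a s' = N / p" by (simp add: cf_prob_def N_def p_def)
  ultimately show "cf_prob P s0 a0 s1 \<theta> s a s' \<le> 1" "cf_prob P s0 a0 s1 \<theta> s a s' \<le> r / p"
    "0 \<le> cf_prob P s0 a0 s1 \<theta> s a s'" "(r - (1 - p)) / p \<le> cf_prob P s0 a0 s1 \<theta> s a s'"
    using p by (auto intro: divide_right_mono)
qed

theorem theorem4p2:
  fixes P :: "'s::finite \<Rightarrow> 'a::finite \<Rightarrow> 's pmf"
    and s0 :: 's and a0 :: 'a and s1 :: 's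
    and s :: 's and a :: 'a and s' :: 's
  assumes observed: "pmf (P s0 a0) s1 > 0"
    and other: "(s, a) \<noteq> (s0, a0)"
    and disjoint: "set_pmf (P s a) \<inter> set_pmf (P s0 a0) = {}"
  shows "is_cf_maximum P s0 a0 s1 s a s'
           (if pmf (P s a) s' < pmf (P s0 a0) s1
            then pmf (P s a) s' / pmf (P s0 a0) s1
            else 1) \<and>
         is_cf_minimum P s0 a0 s1 s a s'
           (if pmf (P s a) s' > 1 - pmf (P s0 a0) s1
            then (pmf (P s a) s' - (1 - pmf (P s0 a0) s1)) / pmf (P s0 a0) s1
            else 0)"
proof -
  define p r where "p = pmf (P s0 a0) s1" and "r = pmf (P s a) s'"
  have p: "0 < p" "p \<le> 1" using observed by (auto simp: p_def pmf_le_1)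
  have r: "0 \<le> r" "r \<le> 1" by (auto simp: r_def pmf_le_1)
  note attained = exists_feasible_disjoint[where s' = s', OF observed other disjoint,
      folded p_def r_def]
  note bounds = cf_prob_frechet_bounds[of P s0 a0 s1 _ s a s', OF observed, folded p_def r_def]
  have "is_cf_maximum P s0 a0 s1 s a s' (if r < p then r / p else 1)"
    unfolding is_cf_maximum_def
  proof (intro conjI allI impI)
    \<comment> \<open>The value is \<open>min 1 (r / p)\<close>. The room condition reads
      \<open>p - r \<le> 1 - r\<close> for \<open>r / p\<close> and \<open>0 \<le> 1 - r\<close> for
      1.\<close>
    show "\<exists>\<theta>. feasible P s0 a0 s1 \<theta> \<and>
        cf_prob P s0 a0 s1 \<theta> s a s' = (if r < p then r / p else 1)"
      using p r by (intro attained) (auto simp: field_simps)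
  qed (use bounds in \<open>auto simp: feasible_def\<close>)
  moreover have "is_cf_minimum P s0 a0 s1 s a s' (if r > 1 - p then (r - (1 - p)) / p else 0)"
    unfolding is_cf_minimum_def
  proof (intro conjI allI impI)
    \<comment> \<open>The value is \<open>max 0 ((r + p - 1) / p)\<close>. The room condition is an
      equality if the value is positive, and \<open>p \<le> 1 - r\<close> otherwise.\<close>
    show "\<exists>\<theta>. feasible P s0 a0 s1 \<theta> \<and>
        cf_prob P s0 a0 s1 \<theta> s a s' = (if r > 1 - p then (r - (1 - p)) / p else 0)"
      using p r by (intro attained) (auto simp: field_simps)
  qed (use bounds in \<open>auto simp: feasible_def\<close>)
  ultimately show ?thesis unfolding p_def r_def ..
qed

end
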